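(* Let $q,k\ge 1$ be fixed integers and let $v_1,\dots,v_k\in\mathbb{R}^q$, $v_l=(v_{l1},\dots,v_{lq})$, be fixed pairwise distinct vectors. For each $n\ge 1$ let $N=kn$ and consider the linear regression model $y_j=\sum_{i=1}^q\theta_i x_{ji}+\epsilon_j$, $j=1,\dots,N$, where $\theta=(\theta_1,\dots,\theta_q)\in\mathbb{R}^q$ is an unknown parameter, the errors $\epsilon_j$ are i.i.d. random variables with distribution function $F$, and the design is as follows: $\{1,\dots,N\}$ is the disjoint union of sets $I_1,\dots,I_k$ with $\operatorname{card}(I_l)=n$, and $(x_{j1},\dots,x_{jq})=v_l$ for all $j\in I_l$, $l=1,\dots,k$. Assume that (A1) the random variables $\epsilon_j$ are symmetric ($\epsilon_j$ and $-\epsilon_j$ have the same distribution); (A2) there are constants $b_n>0$ and $a_n\in\mathbb{R}$ such that $b_n(\max_{1\le j\le n}\epsilon_j-a_n)$ converges in distribution, as $n\to\infty$, to a random variable with distribution function $G$, where $G$ is one of the extreme value distribution functions $\Phi_\alpha$ ($\alpha>0$), $\Psi_\alpha$ ($\alpha>0$), $\Lambda$. Let $\widehat{\Delta}=\min_{\tau\in\mathbb{R}^q}\max_{1\le j\le N}\bigl|y_j-\sum_{i=1}^q\tau_i x_{ji}\bigr|$. Then $$\Delta_n=b_n(\widehat{\Delta}-a_n)\xrightarrow{D}\Delta_0\quad\text{as } n\to\infty,$$ where $$\Delta_0=\max_{u\in\mathcal{D}^*}L_0^*(u),\qquad L_0^*(u)=\sum_{l=1}^k(u_l\zeta_l+u'_l\zeta'_l),\qquad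 u=(u_1,\dots,u_k,u'_1,\dots,u'_k),$$ $$\mathcal{D}^*=\Bigl\{u\ge 0:\ \sum_{l=1}^k(u_l-u'_l)v_{li}=0,\ i=1,\dots,q,\ \ \sum_{l=1}^k(u_l+u'_l)=1\Bigr\},$$ and $\zeta_1,\dots,\zeta_k,\zeta'_1,\dots,\zeta'_k$ are independent random variables each having distribution function $G$.
   Context: The extreme value distribution functions are: $\Phi_\alpha(x)=0$ for $x\le 0$ and $\Phi_\alpha(x)=\exp(-x^{-\alpha})$ for $x>0$ ($\alpha>0$); $\Psi_\alpha(x)=\exp(-(-x)^\alpha)$ for $x\le 0$ and $\Psi_\alpha(x)=1$ for $x>0$ ($\alpha>0$); $\Lambda(x)=\exp(-e^{-x})$, $x\in\mathbb{R}$. The notation $\xrightarrow{D}$ means convergence in distribution, and $u\ge 0$ means that all coordinates of $u$ are nonnegative. *)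

theory Defs
  imports "HOL-Probability.Probability"
begin

definition frechet_cdf :: "real \<Rightarrow> real \<Rightarrow> real" where
  "frechet_cdf \<alpha> x = (if x \<le> 0 then 0 else exp (- (x powr (- \<alpha>))))"

definition weibull_cdf :: "real \<Rightarrow> real \<Rightarrow> real" where
  "weibull_cdf \<alpha> x = (if x \<le> 0 then exp (- ((- x) powr \<alpha>)) else 1)"

definition gumbel_cdf :: "real \<Rightarrow> real" where
  "gumbel_cdf x = exp (- exp (- x))"

definition extreme_value_cdf :: "(real \<Rightarrow> real) \<Rightarrow> bool" where
  "extreme_value_cdf G \<longleftrightarrow>
     (\<exists>\<alpha>>0. G = frechet_cdf \<alpha>) \<or> (\<exists>\<alpha>>0. G = weibull_cdf \<alpha>) \<or> G = gumbel_cdf"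

definition max_residual :: "nat \<Rightarrow> (nat \<Rightarrow> real ^ 'q) \<Rightarrow> (nat \<Rightarrow> real) \<Rightarrow> real ^ 'q \<Rightarrow> real" where
  "max_residual N x y \<tau> = Max ((\<lambda>j. \<bar>y j - (\<Sum>i\<in>UNIV. \<tau> $ i * x j $ i)\<bar>) ` {1..N})"

(* The infimum is a minimum for N >= 1, see minimax_residual_attained. *)
definition minimax_residual :: "nat \<Rightarrow> (nat \<Rightarrow> real ^ 'q) \<Rightarrow> (nat \<Rightarrow> real) \<Rightarrow> real" where
  "minimax_residual N x y = (INF \<tau>. max_residual N x y \<tau>)"

(* A pair (u, u') of vectors in R^k stands for the vector (u_1, ..., u_k, u'_1, ..., u'_k). *)
definition Dstar :: "('k \<Rightarrow> real ^ 'q) \<Rightarrow> ((real ^ 'k) \<times> (real ^ 'k)) set" where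
  "Dstar v = {(u, u'). (\<forall>l. 0 \<le> u $ l \<and> 0 \<le> u' $ l) \<and>
     (\<forall>i. (\<Sum>l\<in>UNIV. (u $ l - u' $ l) * v l $ i) = 0) \<and>
     (\<Sum>l\<in>UNIV. u $ l + u' $ l) = 1}"

definition Lstar :: "('k \<Rightarrow> real) \<Rightarrow> ('k \<Rightarrow> real) \<Rightarrow> (real ^ 'k) \<times> (real ^ 'k) \<Rightarrow> real" where
  "Lstar z z' = (\<lambda>(u, u'). \<Sum>l\<in>UNIV. u $ l * z l + u' $ l * z' l)"

(* The supremum is a maximum, see max_Lstar_attained. *)
definition max_Lstar :: "('k::finite \<Rightarrow> real ^ 'q) \<Rightarrow> ('k \<Rightarrow> real) \<Rightarrow> ('k \<Rightarrow> real) \<Rightarrow> real" where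
  "max_Lstar v z z' = (SUP w\<in>Dstar v. Lstar z z' w)"

lemma continuous_on_Max_image:
  fixes f :: "'i \<Rightarrow> 'a::topological_space \<Rightarrow> real"
  assumes "finite A" "A \<noteq> {}" "\<And>j. j \<in> A \<Longrightarrow> continuous_on S (f j)"
  shows "continuous_on S (\<lambda>t. Max ((\<lambda>j. f j t) ` A))"
  using assms
proof (induction rule: finite_ne_induct)
  case (insert a A)
  have "continuous_on S (\<lambda>t. max (f a t) (Max ((\<lambda>j. f j t) ` A)))"
    using insert by (intro continuous_on_max) auto
  then show ?case using insert by simp
qed simp

lemma max_residual_ge:
  assumes "j \<in> {1..N}"
  shows "\<bar>y j - \<tau> \<bullet> x j\<bar> \<le> max_residual N x y \<tau>"
  using assms unfolding max_residual_def inner_vec_def by (intro Max_ge) auto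

lemma continuous_on_max_residual:
  assumes "N \<ge> 1"
  shows "continuous_on S (max_residual N x y)"
  unfolding max_residual_def[abs_def]
  by (rule continuous_on_Max_image) (use assms in \<open>auto intro!: continuous_intros\<close>)

lemma minimax_residual_attained:
  fixes x :: "nat \<Rightarrow> real ^ 'q"
  assumes N: "N \<ge> 1"
  shows "\<exists>\<tau>. minimax_residual N x y = max_residual N x y \<tau> \<and>
             (\<forall>\<tau>'. max_residual N x y \<tau> \<le> max_residual N x y \<tau>')"
proof -
  define f where "f = max_residual N x y"
  define g where "g = max_residual N x (\<lambda>_. 0)"
  define S where "S = span (x ` {1..N})"
  have cf: "continuous_on T f" and cg: "continuous_on T g" for T
    using continuous_on_max_residual[OF N] unfolding f_def g_def by auto
  have closedS: "closed S" and subS: "subspace S"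
    by (simp_all add: S_def closed_subspace)
  have f_span: "\<exists>p\<in>S. f p = f \<tau>" for \<tau>
  proof -
    obtain p z where p: "p \<in> span (x ` {1..N})"
      and z: "\<And>w. w \<in> span (x ` {1..N}) \<Longrightarrow> orthogonal z w" and eq: "\<tau> = p + z"
      by (rule orthogonal_subspace_decomp_exists[of "x ` {1..N}" \<tau>], blast)
    have "\<tau> \<bullet> x j = p \<bullet> x j" if "j \<in> {1..N}" for j
      using z[of "x j"] that by (auto simp: eq inner_add_left orthogonal_def span_base)
    then have "(\<lambda>j. \<bar>y j - \<tau> \<bullet> x j\<bar>) ` {1..N} = (\<lambda>j. \<bar>y j - p \<bullet> x j\<bar>) ` {1..N}"
      by (intro image_cong) auto
    then have "f p = f \<tau>"
      unfolding f_def max_residual_def by (simp add: inner_vec_def)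
    with p show ?thesis unfolding S_def by blast
  qed
  have g_pos: "0 < g t" if "t \<in> S" "norm t = 1" for t
  proof (rule ccontr)
    assume "\<not> 0 < g t"
    then have "t \<bullet> x j = 0" if "j \<in> {1..N}" for j
      using max_residual_ge[OF that, of "\<lambda>_. 0" t x] by (simp add: g_def)
    then have "\<And>w. w \<in> x ` {1..N} \<Longrightarrow> orthogonal t w" by (auto simp: orthogonal_def)
    then have "orthogonal t t" by (rule orthogonal_to_span[OF that(1)[unfolded S_def]])
    then show False using that(2) by (auto simp: orthogonal_def)
  qed
  obtain m where m: "0 < m" "\<And>t. t \<in> S \<Longrightarrow> norm t = 1 \<Longrightarrow> m \<le> g t"
  proof (cases "S \<inter> sphere 0 1 = {}")
    case True
    then have "1 \<le> g t" if "t \<in> S" "norm t = 1" for t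
      using that by auto
    then show ?thesis by (rule that[OF zero_less_one])
  next
    case False
    have "compact (S \<inter> sphere 0 1)" by (simp add: closed_Int_compact closedS)
    from continuous_attains_inf[OF this False cg]
    obtain s where s: "s \<in> S \<inter> sphere 0 1" "\<forall>t\<in>S \<inter> sphere 0 1. g s \<le> g t" by blast
    show ?thesis by (rule that[of "g s"]) (use s g_pos in auto)
  qed
  define B where "B = Max ((\<lambda>j. \<bar>y j\<bar>) ` {1..N})"
  define R where "R = (\<bar>f 0\<bar> + \<bar>B\<bar>) / m"
  have bound: "norm t \<le> R" if t: "t \<in> S" "f t \<le> f 0" for t
  proof (cases "t = 0")
    case False
    define s where "s = t /\<^sub>R norm t"
    have "s \<in> S" "norm s = 1" using t False subS by (auto simp: s_def subspace_scale)
    then have "m \<le> g s" using m by blast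
    moreover have "g s \<in> (\<lambda>j. \<bar>0 - s \<bullet> x j\<bar>) ` {1..N}"
      using N unfolding g_def max_residual_def inner_vec_def inner_real_def
      by (intro Max_in) auto
    ultimately obtain j where j: "j \<in> {1..N}" "m \<le> \<bar>s \<bullet> x j\<bar>" by auto
    have "\<bar>s \<bullet> x j\<bar> * norm t = \<bar>t \<bullet> x j\<bar>"
      using False by (simp add: s_def abs_mult)
    then have "m * norm t \<le> \<bar>t \<bullet> x j\<bar>"
      using mult_right_mono[OF j(2), of "norm t"] by simp
    also have "\<dots> \<le> \<bar>y j - t \<bullet> x j\<bar> + \<bar>y j\<bar>" by linarith
    also have "\<dots> \<le> f t + B"
      using max_residual_ge[OF j(1), of y t x] j(1) unfolding f_def B_def
      by (intro add_mono Max_ge) auto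
    also have "\<dots> \<le> \<bar>f 0\<bar> + \<bar>B\<bar>" using t(2) by linarith
    finally show ?thesis using m(1) by (simp add: R_def field_simps)
  qed (use m(1) in \<open>simp add: R_def\<close>)
  have "compact (S \<inter> cball 0 R)" by (simp add: closed_Int_compact closedS)
  moreover have zero: "0 \<in> S \<inter> cball 0 R"
    using subS m(1) by (simp add: subspace_0 R_def)
  ultimately obtain p where p: "p \<in> S \<inter> cball 0 R" "\<forall>t\<in>S \<inter> cball 0 R. f p \<le> f t"
    using continuous_attains_inf[OF _ _ cf] by blast
  have min: "f p \<le> f \<tau>" for \<tau>
  proof -
    obtain t where t: "t \<in> S" "f t = f \<tau>" using f_span by blast
    show ?thesis
    proof (cases "f t \<le> f 0")
      case True
      with t bound have "t \<in> S \<inter> cball 0 R" by simp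
      with p t show ?thesis by metis
    next
      case False
      moreover have "f p \<le> f 0" using p zero by blast
      ultimately show ?thesis using t by linarith
    qed
  qed
  then have "(INF \<tau>. f \<tau>) = f p" by (intro cInf_eq_minimum) auto
  with min show ?thesis unfolding f_def minimax_residual_def by blast
qed

lemma max_Lstar_attained:
  fixes v :: "'k::finite \<Rightarrow> real ^ 'q"
  shows "\<exists>w\<in>Dstar v. max_Lstar v z z' = Lstar z z' w \<and> (\<forall>w'\<in>Dstar v. Lstar z z' w' \<le> Lstar z z' w)"
proof -
  define c where "c = (\<chi> l::'k. 1 / (2 * real CARD('k)))"
  have "(c, c) \<in> Dstar v"
    by (simp add: Dstar_def c_def)
  then have ne: "Dstar v \<noteq> {}" by blast
  have eq: "Dstar v =
      {w. \<forall>l. 0 \<le> fst w $ l} \<inter> {w. \<forall>l. 0 \<le> snd w $ l} \<inter>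
      {w. \<forall>i. (\<Sum>l\<in>UNIV. (fst w $ l - snd w $ l) * v l $ i) = 0} \<inter>
      {w. (\<Sum>l\<in>UNIV. fst w $ l + snd w $ l) = 1}"
    by (auto simp: Dstar_def)
  have "closed (Dstar v)"
    unfolding eq
    by (intro closed_Int closed_Collect_all closed_Collect_le closed_Collect_eq continuous_intros)
  moreover have "bounded (Dstar v)"
  proof (rule boundedI)
    fix w assume w: "w \<in> Dstar v"
    obtain u u' where uu: "w = (u, u')" by (cases w)
    have "norm w \<le> norm u + norm u'" unfolding uu by (rule norm_Pair_le)
    also have "\<dots> \<le> (\<Sum>l\<in>UNIV. \<bar>u $ l\<bar>) + (\<Sum>l\<in>UNIV. \<bar>u' $ l\<bar>)"
      by (intro add_mono norm_le_l1_cart)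
    also have "\<dots> = 1" using w by (simp add: uu Dstar_def sum.distrib)
    finally show "norm w \<le> 1" .
  qed
  ultimately have "compact (Dstar v)" by (simp add: compact_eq_bounded_closed)
  moreover have "continuous_on (Dstar v) (Lstar z z')"
    unfolding Lstar_def case_prod_unfold by (intro continuous_intros)
  ultimately obtain w where w: "w \<in> Dstar v" "\<forall>w'\<in>Dstar v. Lstar z z' w' \<le> Lstar z z' w"
    using continuous_attains_sup[OF _ ne] by blast
  then have "max_Lstar v z z' = Lstar z z' w"
    unfolding max_Lstar_def by (intro cSup_eq_maximum) auto
  with w show ?thesis by blast
qed

end

theory Submission
  imports Defs
begin

text \<open>
  The minimax residual is the value of a linear program: minimise, over the deviation \<open>\<beta> = \<tau> - \<theta>\<close>,
  the largest of the numbers \<open>Z l - \<beta> \<bullet> v l\<close> and \<open>Z' l + \<beta> \<bullet> v l\<close>, where \<open>Z l\<close> and \<open>Z' l\<close> are the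
  maxima of \<open>\<epsilon> j\<close> and of \<open>- \<epsilon> j\<close> over the group \<open>l\<close>. Linear programming duality turns it, for every
  sample and every \<open>n\<close>, into the maximum of the linear form with coefficients \<open>Z, Z'\<close> over the
  polytope of dual weights (\<open>minimax_residual_eq_max_Lstar\<close>). This polytope does not depend on \<open>n\<close>,
  and since its weights sum to one the normalisation by \<open>a n\<close> and \<open>b n\<close> passes through the
  maximum (\<open>max_Lstar_affine\<close>). The normalised residual is therefore one fixed continuous function
  of the normalised group extremes.

  It remains to find the joint limit of these extremes. Groups are independent, and within a group
  the normalised maxima of \<open>\<epsilon> j\<close> and \<open>- \<epsilon> j\<close> become independent in the limit, because the
  probability that a single error respects both thresholds differs from the product of the two
  probabilities only by a product of two small exceedance probabilities
  (\<open>asymptotic_independence_of_extremes\<close>). By symmetry of the errors both maxima have the same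
  limit law \<open>G\<close>, so the joint distribution functions converge to products of values of \<open>G\<close>, that
  is, to the joint distribution function of the variables \<open>\<zeta>, \<zeta>'\<close>; the convergence holds at
  every point as \<open>G\<close> is continuous. A continuous mapping theorem for random vectors
  (\<open>joint_cdf_tendsto_imp_weak_conv_continuous_image\<close>) finishes the proof.
\<close>

section \<open>Linear programming duality for the Chebyshev fit\<close>

text \<open>
  Distinct indices may carry the same point, so the coefficients that a point of the hull has over
  the \<^emph>\<open>set\<close> of points are transferred to one chosen index per point.
\<close>

lemma convex_hull_image_coefficients:
  fixes w :: "'i::finite \<Rightarrow> 'a::real_vector"
  assumes "p \<in> convex hull (w ` A)"
  obtains U where "\<And>i. 0 \<le> U i" "\<And>i. i \<notin> A \<Longrightarrow> U i = 0"
    "(\<Sum>i\<in>UNIV. U i) = 1" "(\<Sum>i\<in>UNIV. U i *\<^sub>R w i) = p"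
proof -
  obtain B where B: "B \<subseteq> A" "inj_on w B" "w ` A = w ` B"
    using subset_image_inj[of "w ` A" w A] by auto
  obtain u where u: "\<forall>x\<in>w ` B. 0 \<le> u x" "sum u (w ` B) = 1" "(\<Sum>x\<in>w ` B. u x *\<^sub>R x) = p"
    using assms B(3) by (auto simp: convex_hull_finite)
  define U where "U i = (if i \<in> B then u (w i) else 0)" for i
  have "(\<Sum>i\<in>UNIV. U i) = (\<Sum>i\<in>B. u (w i))"
    by (rule sum.mono_neutral_cong_right) (auto simp: U_def)
  also have "\<dots> = 1" using u(2) B(2) by (simp add: sum.reindex)
  finally have 1: "(\<Sum>i\<in>UNIV. U i) = 1" .
  have "(\<Sum>i\<in>UNIV. U i *\<^sub>R w i) = (\<Sum>i\<in>B. u (w i) *\<^sub>R w i)"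
    by (rule sum.mono_neutral_cong_right) (auto simp: U_def)
  also have "\<dots> = p" using u(3) B(2) by (simp add: sum.reindex)
  finally have 2: "(\<Sum>i\<in>UNIV. U i *\<^sub>R w i) = p" .
  show thesis
    by (rule that[of U]) (use 1 2 u(1) B(1) in \<open>auto simp: U_def\<close>)
qed

text \<open>
  Strong duality for minimising the maximum of finitely many affine functions
  \<open>\<beta> \<mapsto> c i - \<beta> \<bullet> w i\<close>, in the form of a certificate at a minimiser. Only the active indices,
  where the maximum is attained, matter near the minimiser. If \<open>0\<close> were not in the convex hull of
  their gradients, a separating direction \<open>d\<close> would make every active function decrease strictly,
  while the inactive ones stay below \<open>m\<close> for a short step, contradicting minimality. The convex
  coefficients that represent \<open>0\<close> then form the dual solution; as they live on active indices, the
  dual value is \<open>m\<close>.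
\<close>

lemma minimax_affine_certificate:
  fixes w :: "'i::finite \<Rightarrow> 'a::euclidean_space"
  assumes upper: "\<And>i. c i - \<beta> \<bullet> w i \<le> m"
    and minimal: "\<And>\<gamma>. \<exists>i. m \<le> c i - \<gamma> \<bullet> w i"
  obtains U where "\<And>i. 0 \<le> U i" "(\<Sum>i\<in>UNIV. U i) = 1"
    "(\<Sum>i\<in>UNIV. U i *\<^sub>R w i) = 0" "(\<Sum>i\<in>UNIV. U i * c i) = m"
proof -
  define A where "A = {i. c i - \<beta> \<bullet> w i = m}"
  have "0 \<in> convex hull (w ` A)"
  proof (rule ccontr)
    assume "0 \<notin> convex hull (w ` A)"
    moreover have "closed (convex hull (w ` A))"
      by (intro compact_imp_closed finite_imp_compact_convex_hull) simp
    ultimately obtain d r where r: "0 < r" and d: "\<And>p. p \<in> convex hull (w ` A) \<Longrightarrow> d \<bullet> p > r"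
      using separating_hyperplane_closed_0[OF convex_convex_hull] by blast
    have "\<forall>\<^sub>F t in at_right 0. c i - (\<beta> + t *\<^sub>R d) \<bullet> w i < m" for i
    proof (cases "i \<in> A")
      case True
      then have "d \<bullet> w i > 0" using d[OF hull_inc[of "w i"]] r by force
      then show ?thesis
        using True by (auto simp: A_def eventually_at_filter inner_add_left)
    next
      case False
      then have "c i - (\<beta> + 0 *\<^sub>R d) \<bullet> w i < m" using upper[of i] by (auto simp: A_def)
      moreover have "((\<lambda>t. c i - (\<beta> + t *\<^sub>R d) \<bullet> w i) \<longlongrightarrow> c i - (\<beta> + 0 *\<^sub>R d) \<bullet> w i) (at_right 0)"
        by (intro tendsto_intros)
      ultimately show ?thesis by (rule order_tendstoD(2)[rotated])
    qed
    then have "\<forall>\<^sub>F t in at_right 0. \<forall>i. c i - (\<beta> + t *\<^sub>R d) \<bullet> w i < m"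
      by (simp add: eventually_all_finite)
    then obtain t where "\<forall>i. c i - (\<beta> + t *\<^sub>R d) \<bullet> w i < m"
      using eventually_happens[of _ "at_right (0::real)"] by force
    with minimal[of "\<beta> + t *\<^sub>R d"] show False by (meson not_less)
  qed
  then obtain U where U: "\<And>i. 0 \<le> U i" "\<And>i. i \<notin> A \<Longrightarrow> U i = 0"
    "(\<Sum>i\<in>UNIV. U i) = 1" "(\<Sum>i\<in>UNIV. U i *\<^sub>R w i) = 0"
    using convex_hull_image_coefficients by blast
  have "(\<Sum>i\<in>UNIV. U i * c i) = (\<Sum>i\<in>UNIV. U i * m + \<beta> \<bullet> (U i *\<^sub>R w i))"
  proof (rule sum.cong)
    fix i show "U i * c i = U i * m + \<beta> \<bullet> (U i *\<^sub>R w i)"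
      using U(2)[of i] by (cases "i \<in> A") (auto simp: A_def algebra_simps)
  qed simp
  also have "\<dots> = (\<Sum>i\<in>UNIV. U i) * m + \<beta> \<bullet> (\<Sum>i\<in>UNIV. U i *\<^sub>R w i)"
    by (simp only: sum.distrib sum_distrib_right inner_sum_right)
  also have "\<dots> = m" using U(3,4) by simp
  finally show thesis using U by (intro that[of U])
qed

text \<open>
  Weak duality: for weights in the dual polytope the balance equations cancel every contribution
  of \<open>\<beta>\<close>, and what remains is a convex combination of numbers below \<open>r\<close>.
\<close>

lemma Lstar_le_residual_bound:
  fixes v :: "'k::finite \<Rightarrow> real ^ 'q"
  assumes D: "p \<in> Dstar v"
    and r: "\<And>l. z l - \<beta> \<bullet> v l \<le> r" "\<And>l. z' l + \<beta> \<bullet> v l \<le> r"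
  shows "Lstar z z' p \<le> r"
proof -
  obtain u u' where p: "p = (u, u')" by (cases p)
  have pos: "\<And>l. 0 \<le> u $ l" "\<And>l. 0 \<le> u' $ l"
    and bal: "\<And>i. (\<Sum>l\<in>UNIV. (u $ l - u' $ l) * v l $ i) = 0"
    and tot: "(\<Sum>l\<in>UNIV. u $ l + u' $ l) = 1"
    using D by (auto simp: p Dstar_def)
  have "(\<Sum>l\<in>UNIV. (u $ l - u' $ l) *\<^sub>R v l) = 0"
    by (simp add: vec_eq_iff bal)
  then have "(\<Sum>l\<in>UNIV. (u $ l - u' $ l) * (\<beta> \<bullet> v l)) = 0"
    by (metis (mono_tags, lifting) inner_scaleR_right inner_sum_right inner_zero_right sum.cong)
  then have "Lstar z z' p =
      (\<Sum>l\<in>UNIV. u $ l * z l + u' $ l * z' l) - (\<Sum>l\<in>UNIV. (u $ l - u' $ l) * (\<beta> \<bullet> v l))"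
    by (simp add: p Lstar_def)
  also have "\<dots> = (\<Sum>l\<in>UNIV. u $ l * (z l - \<beta> \<bullet> v l) + u' $ l * (z' l + \<beta> \<bullet> v l))"
    by (simp add: algebra_simps flip: sum_subtractf)
  also have "\<dots> \<le> (\<Sum>l\<in>UNIV. u $ l * r + u' $ l * r)"
    by (intro sum_mono add_mono mult_left_mono r pos)
  also have "\<dots> = r"
    using tot by (simp flip: distrib_right sum_distrib_right)
  finally show ?thesis .
qed

lemma UNIV_sum_split:
  fixes f :: "'a::finite + 'b::finite \<Rightarrow> 'c::comm_monoid_add"
  shows "(\<Sum>i\<in>UNIV. f i) = (\<Sum>l\<in>UNIV. f (Inl l)) + (\<Sum>l\<in>UNIV. f (Inr l))"
  by (simp add: UNIV_Plus_UNIV[symmetric] sum.Plus del: UNIV_Plus_UNIV)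

text \<open>
  Weak duality bounds the dual value by the optimal value \<open>m\<close> of the primal program, and the
  certificate at the primal solution \<open>\<beta>\<close> attains it. For the certificate the two families of
  inequalities are merged into one, indexed by a sum type, with gradients \<open>v l\<close> and \<open>- v l\<close>.
\<close>

lemma max_Lstar_eqI:
  fixes v :: "'k::finite \<Rightarrow> real ^ 'q"
  assumes upper: "\<And>l. z l - \<beta> \<bullet> v l \<le> m" "\<And>l. z' l + \<beta> \<bullet> v l \<le> m"
    and minimal: "\<And>\<gamma> r. (\<And>l. z l - \<gamma> \<bullet> v l \<le> r) \<Longrightarrow> (\<And>l. z' l + \<gamma> \<bullet> v l \<le> r) \<Longrightarrow> m \<le> r"
  shows "max_Lstar v z z' = m"
proof -
  define w where "w = case_sum v (\<lambda>l. - v l)"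
  define c where "c = case_sum z z'"
  have "c i - \<beta> \<bullet> w i \<le> m" for i
    using upper by (cases i) (auto simp: c_def w_def)
  moreover have "\<exists>i. m \<le> c i - \<gamma> \<bullet> w i" for \<gamma>
  proof -
    define r where "r = Max (range (\<lambda>i. c i - \<gamma> \<bullet> w i))"
    have le: "c i - \<gamma> \<bullet> w i \<le> r" for i unfolding r_def by (intro Max_ge) auto
    have "m \<le> r"
      by (rule minimal[of \<gamma>]) (use le[of "Inl _"] le[of "Inr _"] in \<open>auto simp: c_def w_def\<close>)
    moreover have "r \<in> range (\<lambda>i. c i - \<gamma> \<bullet> w i)" unfolding r_def by (intro Max_in) auto
    ultimately show ?thesis by auto
  qed
  ultimately obtain U where U: "\<And>i. 0 \<le> U i" "(\<Sum>i\<in>UNIV. U i) = 1"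
    "(\<Sum>i\<in>UNIV. U i *\<^sub>R w i) = 0" "(\<Sum>i\<in>UNIV. U i * c i) = m"
    using minimax_affine_certificate[of c \<beta> w m] by blast
  define p where "p = ((\<chi> l. U (Inl l)), (\<chi> l. U (Inr l)))"
  have "(\<Sum>l\<in>UNIV. (U (Inl l) - U (Inr l)) * v l $ i) = (\<Sum>i\<in>UNIV. U i *\<^sub>R w i) $ i" for i
    by (simp add: UNIV_sum_split w_def algebra_simps sum_negf flip: sum_subtractf)
  then have "(\<Sum>l\<in>UNIV. (U (Inl l) - U (Inr l)) * v l $ i) = 0" for i
    unfolding U(3) by simp
  then have "p \<in> Dstar v"
    using U by (simp add: p_def Dstar_def UNIV_sum_split sum.distrib)
  moreover have "Lstar z z' p = m"
    using U(4) by (simp add: p_def Lstar_def UNIV_sum_split c_def sum.distrib)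
  ultimately show ?thesis
    unfolding max_Lstar_def
    by (intro cSup_eq_maximum) (use Lstar_le_residual_bound[OF _ upper] in force)+
qed

text \<open>
  The exact, non-asymptotic identity behind the limit theorem. Within a group all design points
  agree, so the residuals of the group are extreme at its largest and its smallest error, and
  fitting reduces to the linear program that the optimality criterion solves.
  The parameter \<open>\<theta>\<close> disappears because only the deviation \<open>\<tau> - \<theta>\<close> enters the residuals.
\<close>

lemma minimax_residual_eq_max_Lstar:
  fixes v :: "'k::finite \<Rightarrow> real ^ 'q"
  assumes N: "N \<ge> 1"
    and union: "(\<Union>l. J l) = {1..N}"
    and ne: "\<And>l. J l \<noteq> {}"
    and points: "\<And>l j. j \<in> J l \<Longrightarrow> x j = v l"
    and model: "\<And>j. j \<in> {1..N} \<Longrightarrow> y j = \<theta> \<bullet> x j + e j"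
  shows "minimax_residual N x y =
    max_Lstar v (\<lambda>l. Max (e ` J l)) (\<lambda>l. Max ((\<lambda>j. - e j) ` J l))"
proof -
  have fin: "finite (J l)" for l
    using union by (metis UN_upper UNIV_I finite_atLeastAtMost finite_subset)
  have res_le: "max_residual N x y (\<theta> + \<beta>) \<le> r \<longleftrightarrow>
      (\<forall>l. Max (e ` J l) - \<beta> \<bullet> v l \<le> r) \<and> (\<forall>l. Max ((\<lambda>j. - e j) ` J l) + \<beta> \<bullet> v l \<le> r)" for \<beta> r
  proof -
    have "max_residual N x y (\<theta> + \<beta>) = Max ((\<lambda>j. \<bar>e j - \<beta> \<bullet> x j\<bar>) ` {1..N})"
      unfolding max_residual_def using model
      by (intro arg_cong[where f = Max] image_cong)
        (auto simp: inner_vec_def sum.distrib distrib_right)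
    then have "max_residual N x y (\<theta> + \<beta>) \<le> r \<longleftrightarrow> (\<forall>j\<in>\<Union>l. J l. \<bar>e j - \<beta> \<bullet> x j\<bar> \<le> r)"
      using N by (simp add: union)
    also have "\<dots> \<longleftrightarrow> (\<forall>l. \<forall>j\<in>J l. e j \<le> r + \<beta> \<bullet> v l) \<and> (\<forall>l. \<forall>j\<in>J l. - e j \<le> r - \<beta> \<bullet> v l)"
      by (force simp: points abs_le_iff)
    also have "\<dots> \<longleftrightarrow> (\<forall>l. Max (e ` J l) \<le> r + \<beta> \<bullet> v l) \<and> (\<forall>l. Max ((\<lambda>j. - e j) ` J l) \<le> r - \<beta> \<bullet> v l)"
      using fin ne by simp
    finally show ?thesis by (simp add: algebra_simps)
  qed
  obtain \<tau> where \<tau>: "minimax_residual N x y = max_residual N x y \<tau>"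
    and min: "\<And>\<tau>'. max_residual N x y \<tau> \<le> max_residual N x y \<tau>'"
    using minimax_residual_attained[OF N] by blast
  have eq: "\<theta> + (\<tau> - \<theta>) = \<tau>" by simp
  have opt: "(\<forall>l. Max (e ` J l) - (\<tau> - \<theta>) \<bullet> v l \<le> max_residual N x y \<tau>)
      \<and> (\<forall>l. Max ((\<lambda>j. - e j) ` J l) + (\<tau> - \<theta>) \<bullet> v l \<le> max_residual N x y \<tau>)"
    using res_le[of "\<tau> - \<theta>" "max_residual N x y \<tau>"] unfolding eq by simp
  show ?thesis unfolding \<tau>
  proof (rule max_Lstar_eqI[symmetric, where \<beta> = "\<tau> - \<theta>"])
    fix \<gamma> r
    assume "\<And>l. Max (e ` J l) - \<gamma> \<bullet> v l \<le> r" "\<And>l. Max ((\<lambda>j. - e j) ` J l) + \<gamma> \<bullet> v l \<le> r"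
    then have "max_residual N x y (\<theta> + \<gamma>) \<le> r" using res_le by blast
    with min[of "\<theta> + \<gamma>"] show "max_residual N x y \<tau> \<le> r" by linarith
  qed (use opt in auto)
qed

text \<open>
  The dual weights are nonnegative and sum to one, so raising each coordinate by at most \<open>d\<close>
  raises the value by at most \<open>d\<close>. Used in both directions, this is a Lipschitz bound.
\<close>

lemma max_Lstar_le_shift:
  assumes "\<And>l. z l \<le> t l + d" "\<And>l. z' l \<le> t' l + d"
  shows "max_Lstar v z z' \<le> max_Lstar v t t' + d"
proof -
  obtain p where p: "p \<in> Dstar v" "max_Lstar v z z' = Lstar z z' p"
    using max_Lstar_attained by blast
  obtain u u' where uu: "p = (u, u')" by (cases p)
  have pos: "\<And>l. 0 \<le> u $ l" "\<And>l. 0 \<le> u' $ l" and tot: "(\<Sum>l\<in>UNIV. u $ l + u' $ l) = 1"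
    using p(1) by (auto simp: uu Dstar_def)
  have "Lstar z z' p \<le> (\<Sum>l\<in>UNIV. u $ l * (t l + d) + u' $ l * (t' l + d))"
    unfolding uu Lstar_def prod.case
    by (intro sum_mono add_mono mult_left_mono pos assms)
  also have "\<dots> = Lstar t t' p + (\<Sum>l\<in>UNIV. u $ l + u' $ l) * d"
    by (simp add: uu Lstar_def algebra_simps sum.distrib sum_distrib_left)
  also have "\<dots> \<le> max_Lstar v t t' + d"
    using max_Lstar_attained[of v t t'] p(1) tot by auto
  finally show ?thesis by (simp add: p)
qed

lemma max_Lstar_affine:
  assumes "0 \<le> b"
  shows "max_Lstar v (\<lambda>l. b * (z l - a)) (\<lambda>l. b * (z' l - a)) = b * (max_Lstar v z z' - a)"
proof -
  have aff: "Lstar (\<lambda>l. b * (z l - a)) (\<lambda>l. b * (z' l - a)) p = b * (Lstar z z' p - a)"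
    if "p \<in> Dstar v" for p
  proof -
    obtain u u' where uu: "p = (u, u')" by (cases p)
    have tot: "(\<Sum>l\<in>UNIV. u $ l + u' $ l) = 1"
      using that by (auto simp: uu Dstar_def)
    have "Lstar (\<lambda>l. b * (z l - a)) (\<lambda>l. b * (z' l - a)) p
        = b * (Lstar z z' p - (\<Sum>l\<in>UNIV. u $ l + u' $ l) * a)"
      unfolding uu Lstar_def prod.case sum_distrib_right
      unfolding sum_distrib_left sum_subtractf[symmetric]
      by (rule sum.cong) (simp_all add: algebra_simps)
    then show ?thesis by (simp add: tot)
  qed
  obtain p where p: "p \<in> Dstar v" "max_Lstar v z z' = Lstar z z' p"
    "\<And>p'. p' \<in> Dstar v \<Longrightarrow> Lstar z z' p' \<le> Lstar z z' p"
    using max_Lstar_attained by blast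
  show ?thesis
    unfolding max_Lstar_def[of v "\<lambda>l. b * (z l - a)"] p(2)
  proof (rule cSup_eq_maximum)
    show "b * (Lstar z z' p - a) \<in> Lstar (\<lambda>l. b * (z l - a)) (\<lambda>l. b * (z' l - a)) ` Dstar v"
      using aff[OF p(1)] p(1) by (metis imageI)
  qed (use p(3) assms in \<open>auto simp: aff intro!: mult_left_mono\<close>)
qed

lemma continuous_on_max_Lstar:
  "continuous_on S (\<lambda>x :: real ^ ('k::finite + 'k). max_Lstar v (\<lambda>l. x $ Inl l) (\<lambda>l. x $ Inr l))"
proof -
  let ?h = "\<lambda>x :: real ^ ('k + 'k). max_Lstar v (\<lambda>l. x $ Inl l) (\<lambda>l. x $ Inr l)"
  have le: "?h x \<le> ?h y + dist x y" for x y
  proof (rule max_Lstar_le_shift)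
    show "x $ Inl l \<le> y $ Inl l + dist x y" "x $ Inr l \<le> y $ Inr l + dist x y" for l
      using dist_vec_nth_le[of x "Inl l" y] dist_vec_nth_le[of x "Inr l" y]
      by (simp_all add: dist_real_def abs_le_iff)
  qed
  have "1-lipschitz_on S ?h"
  proof (rule lipschitz_onI)
    fix x y show "dist (?h x) (?h y) \<le> 1 * dist x y"
      using le[of x y] le[of y x] by (simp add: dist_real_def dist_commute abs_le_iff)
  qed simp
  then show ?thesis by (rule lipschitz_on_continuous_on)
qed

section \<open>From joint distribution functions to weak convergence of continuous images\<close>

text \<open>
  Convergence on half-open boxes follows from convergence on orthants by inclusion and exclusion,
  organised as an induction over the set \<open>S\<close> of coordinates that are bounded from below: adding a
  lower bound for one coordinate subtracts a box with fewer lower bounds and a smaller corner.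
\<close>

lemma box_measure_tendsto:
  fixes \<mu> :: "nat \<Rightarrow> (real ^ 'i) measure" and s t :: "'i \<Rightarrow> real"
  assumes fin: "\<And>n. finite_measure (\<mu> n)" "finite_measure \<nu>"
    and sets: "\<And>n. sets (\<mu> n) = sets borel" "sets \<nu> = sets borel"
    and conv: "\<And>t. (\<lambda>n. measure (\<mu> n) {x. \<forall>i. x $ i \<le> t i}) \<longlonglongrightarrow> measure \<nu> {x. \<forall>i. x $ i \<le> t i}"
  shows "(\<lambda>n. measure (\<mu> n) {x. (\<forall>i. x $ i \<le> t i) \<and> (\<forall>i\<in>S. s i < x $ i)})
    \<longlonglongrightarrow> measure \<nu> {x. (\<forall>i. x $ i \<le> t i) \<and> (\<forall>i\<in>S. s i < x $ i)}"
proof -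
  define Q where "Q S t = {x :: real ^ 'i. (\<forall>i. x $ i \<le> t i) \<and> (\<forall>i\<in>S. s i < x $ i)}" for S t
  have Q_borel: "Q S t \<in> sets borel" for S t
    unfolding Q_def by measurable
  have "finite S" by simp
  then have "(\<lambda>n. measure (\<mu> n) (Q S t)) \<longlonglongrightarrow> measure \<nu> (Q S t)"
  proof (induction S arbitrary: t rule: finite_induct)
    case empty
    then show ?case using conv by (simp add: Q_def)
  next
    case (insert j S)
    (* The minimum covers the case that the new interval is empty: then nothing is left over. *)
    define t' where "t' = t(j := min (s j) (t j))"
    have sub: "Q S t' \<subseteq> Q S t" unfolding Q_def t'_def by (auto split: if_splits)
    have "Q (insert j S) t = Q S t - Q S t'"
      using insert(2) by (auto simp: Q_def t'_def not_le split: if_splits)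
    then have diff: "measure \<rho> (Q (insert j S) t) = measure \<rho> (Q S t) - measure \<rho> (Q S t')"
      if "finite_measure \<rho>" "sets \<rho> = sets borel" for \<rho>
      using finite_measure.finite_measure_Diff[OF that(1)] sub Q_borel that(2) by metis
    show ?case
      unfolding diff[OF fin(1) sets(1)] diff[OF fin(2) sets(2)] by (intro tendsto_diff insert.IH)
  qed
  then show ?thesis by (simp add: Q_def)
qed

text \<open>
  One large box carries almost all mass of the limit, hence eventually of \<open>\<mu> n\<close> as well, which
  is the tightness that the argument requires. On that box \<open>f\<close> is uniformly continuous and therefore
  uniformly close to a combination of indicators of small grid cells, whose integrals converge
  by the convergence on half-open boxes.
\<close>

lemma joint_cdf_tendsto_imp_integral_tendsto:
  fixes \<mu> :: "nat \<Rightarrow> (real ^ 'i) measure" and f :: "real ^ 'i \<Rightarrow> real"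
  assumes prob: "\<And>n. prob_space (\<mu> n)" "prob_space \<nu>"
    and sets: "\<And>n. sets (\<mu> n) = sets borel" "sets \<nu> = sets borel"
    and conv: "\<And>t. (\<lambda>n. measure (\<mu> n) {x. \<forall>i. x $ i \<le> t i}) \<longlonglongrightarrow> measure \<nu> {x. \<forall>i. x $ i \<le> t i}"
    and cont: "continuous_on UNIV f" and bound: "\<And>x. \<bar>f x\<bar> \<le> 1"
  shows "(\<lambda>n. integral\<^sup>L (\<mu> n) f) \<longlonglongrightarrow> integral\<^sup>L \<nu> f"
proof (rule tendstoI)
  fix e0 :: real assume "0 < e0"
  (* The error budget: uniform approximation and mass outside the box, each once for \<mu> n and
     once for \<nu>, and the convergence of the integrals of the step function. *)
  define e where "e = e0 / 5"
  have e: "0 < e" "e0 = 5 * e" using \<open>0 < e0\<close> by (auto simp: e_def)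
  have fin: "\<And>n. finite_measure (\<mu> n)" "finite_measure \<nu>"
    using prob by (auto intro: prob_space.finite_measure)
  note box_conv = box_measure_tendsto[OF fin sets conv]
  define B where "B k = {x :: real ^ 'i. (\<forall>i. x $ i \<le> real k) \<and> (\<forall>i\<in>UNIV. - real k < x $ i)}" for k
  have B_borel: "B k \<in> sets borel" for k unfolding B_def by measurable
  have "(\<lambda>k. measure \<nu> (B k)) \<longlonglongrightarrow> measure \<nu> (\<Union>k. B k)"
  proof (rule finite_measure.finite_Lim_measure_incseq[OF fin(2)])
    show "range B \<subseteq> sets \<nu>" using B_borel sets by auto
    show "incseq B"
      by (rule incseq_SucI, unfold B_def of_nat_Suc) (smt (verit) Collect_mono)
  qed
  moreover have "(\<Union>k. B k) = UNIV"
  proof -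
    have "x \<in> (\<Union>k. B k)" for x
    proof -
      obtain k where k: "norm x < real k" using reals_Archimedean2 by blast
      have "\<bar>x $ i\<bar> < real k" for i
        using component_le_norm_cart[of x i] k by linarith
      then have "x \<in> B k" by (auto simp: B_def abs_less_iff less_imp_le minus_less_iff)
      then show ?thesis by blast
    qed
    then show ?thesis by blast
  qed
  moreover have "measure \<nu> UNIV = 1"
    using prob_space.prob_space[OF prob(2)] sets_eq_imp_space_eq[OF sets(2)] by simp
  ultimately have "(\<lambda>k. measure \<nu> (B k)) \<longlonglongrightarrow> 1" by simp
  from order_tendstoD(1)[OF this, of "1 - e"] e obtain K where K: "1 - e < measure \<nu> (B K)"
    by (auto simp: eventually_sequentially)
  let ?C = "cbox (\<chi> i. - real K) (\<chi> i. real K) :: (real ^ 'i) set"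
  have "uniformly_continuous_on ?C f"
    by (intro compact_uniformly_continuous compact_cbox continuous_on_subset[OF cont]) auto
  from uniformly_continuous_onE[OF this \<open>0 < e\<close>]
  obtain \<delta> where \<delta>: "0 < \<delta>" "\<And>x x'. x \<in> ?C \<Longrightarrow> x' \<in> ?C \<Longrightarrow> dist x' x < \<delta> \<Longrightarrow> dist (f x') (f x) < e"
    by blast
  obtain m :: nat where m: "real CARD('i) / \<delta> < real m" using reals_Archimedean2 by blast
  have m0: "0 < real m" using m \<delta>(1) by (smt (verit) divide_nonneg_pos of_nat_0_le_iff)
  have m\<delta>: "real CARD('i) / real m < \<delta>" using m m0 \<delta>(1) by (simp add: field_simps)
  (* Cells are indexed by coordinatewise rounding up to multiples of 1/m; the corner of a cell is
     its upper one, which keeps the rounded point inside the box. *)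
  define G where "G = (UNIV \<rightarrow>\<^sub>E {- (int m * int K)<..int m * int K} :: ('i \<Rightarrow> int) set)"
  define cell where "cell g = {x :: real ^ 'i. \<forall>i. \<lceil>real m * x $ i\<rceil> = g i}" for g
  define corner where "corner g = (\<chi> i. real_of_int (g i) / real m)" for g :: "'i \<Rightarrow> int"
  define s where "s x = (\<Sum>g\<in>G. f (corner g) * indicator (cell g) x)" for x
  have finG: "finite G" unfolding G_def by (intro finite_PiE) auto
  have in_cell: "x \<in> cell g \<longleftrightarrow> g = (\<lambda>i. \<lceil>real m * x $ i\<rceil>)" for x g
    by (auto simp: cell_def)
  have cell_eq: "cell g = {x. (\<forall>i. x $ i \<le> real_of_int (g i) / real m)
      \<and> (\<forall>i\<in>UNIV. (real_of_int (g i) - 1) / real m < x $ i)}" for g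
    unfolding cell_def using m0 by (auto simp: ceiling_eq_iff field_simps)
  have cell_borel: "cell g \<in> sets borel" for g
    unfolding cell_eq by measurable
  have index: "x \<in> B K \<longleftrightarrow> (\<lambda>i. \<lceil>real m * x $ i\<rceil>) \<in> G" for x
  proof -
    have "(x $ i \<le> real K \<and> - real K < x $ i) \<longleftrightarrow>
        \<lceil>real m * x $ i\<rceil> \<in> {- (int m * int K)<..int m * int K}" for i
      using m0 mult_le_cancel_left_pos[OF m0, of "x $ i" "real K"]
        mult_less_cancel_left_pos[OF m0, of "- real K" "x $ i"]
      by (auto simp: ceiling_le_iff less_ceiling_iff)
    then show ?thesis by (auto simp: B_def G_def PiE_iff extensional_def)
  qed
  have approx: "\<bar>f x - s x\<bar> \<le> e + (1 - indicator (B K) x)" for x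
  proof (cases "x \<in> B K")
    case False
    have "s x = 0" unfolding s_def
    proof (rule sum.neutral, intro ballI)
      fix g assume "g \<in> G"
      then have "x \<notin> cell g" using False index[of x] in_cell[of x g] by blast
      then show "f (corner g) * indicator (cell g) x = 0" by simp
    qed
    then show ?thesis using False bound[of x] e by simp
  next
    case True
    define g where "g = (\<lambda>i. \<lceil>real m * x $ i\<rceil>)"
    have g: "g \<in> G" using True index by (simp add: g_def)
    have "s x = (\<Sum>g'\<in>G. if g' = g then f (corner g) else 0)"
      unfolding s_def by (rule sum.cong) (auto simp: in_cell simp flip: g_def)
    then have sx: "s x = f (corner g)" using g finG by simp
    have "\<bar>corner g $ i - x $ i\<bar> \<le> 1 / real m" for i
    proof -
      have "x \<in> cell g" by (simp add: in_cell g_def)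
      then have "x $ i \<le> corner g $ i" "corner g $ i - 1 / real m < x $ i"
        by (auto simp: cell_eq corner_def diff_divide_distrib)
      then show ?thesis by (simp add: abs_le_iff)
    qed
    then have "(\<Sum>i\<in>UNIV. \<bar>(corner g - x) $ i\<bar>) \<le> (\<Sum>i\<in>(UNIV::'i set). 1 / real m)"
      by (intro sum_mono) auto
    then have "dist (corner g) x < \<delta>"
      using norm_le_l1_cart[of "corner g - x"] m\<delta> by (simp add: dist_norm)
    moreover have "x \<in> ?C" using True by (auto simp: B_def mem_box_cart less_imp_le)
    moreover have "corner g \<in> ?C"
    proof -
      have "- (int m * int K) \<le> g i" "g i \<le> int m * int K" for i
        using g by (auto simp: G_def PiE_iff less_imp_le)
      then have "real_of_int (- (int m * int K)) \<le> real_of_int (g i)"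
        "real_of_int (g i) \<le> real_of_int (int m * int K)" for i
        by (simp_all only: of_int_le_iff)
      then show ?thesis using m0 by (simp add: mem_box_cart corner_def field_simps)
    qed
    ultimately have "dist (f (corner g)) (f x) < e" using \<delta>(2) by blast
    then show ?thesis using True sx by (simp add: dist_real_def abs_minus_commute)
  qed
  have s_meas: "s \<in> borel_measurable borel"
    unfolding s_def[abs_def] by (intro borel_measurable_sum borel_measurable_times
      borel_measurable_const borel_measurable_indicator cell_borel)
  have integral_s: "integral\<^sup>L \<rho> s = (\<Sum>g\<in>G. f (corner g) * measure \<rho> (cell g))"
    and error: "\<bar>integral\<^sup>L \<rho> f - integral\<^sup>L \<rho> s\<bar> \<le> e + (1 - measure \<rho> (B K))"
    if p: "prob_space \<rho>" and sets': "sets \<rho> = sets borel" for \<rho>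
  proof -
    interpret prob_space \<rho> by fact
    have sp: "space \<rho> = UNIV" using sets_eq_imp_space_eq[OF sets'] by simp
    have ci: "cell g \<in> events" "B K \<in> events" for g using cell_borel B_borel sets' by auto
    have ind: "integrable \<rho> (\<lambda>x. indicator A x :: real)" if "A \<in> events" for A
      using that by (simp add: integrable_indicator_iff emeasure_eq_measure sp)
    have int_s: "integrable \<rho> s"
      unfolding s_def[abs_def] by (intro Bochner_Integration.integrable_sum integrable_mult_right ind ci)
    have int_f: "integrable \<rho> f"
      using bound cont
      by (intro integrable_const_bound[of _ 1])
        (auto simp: borel_measurable_continuous_onI measurable_cong_sets[OF sets' refl])
    show "integral\<^sup>L \<rho> s = (\<Sum>g\<in>G. f (corner g) * measure \<rho> (cell g))"
      unfolding s_def[abs_def] using ci ind by (subst Bochner_Integration.integral_sum) (auto simp: sp)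
    have "\<bar>integral\<^sup>L \<rho> f - integral\<^sup>L \<rho> s\<bar> = \<bar>\<integral>x. f x - s x \<partial>\<rho>\<bar>"
      using int_f int_s by simp
    also have "\<dots> \<le> (\<integral>x. \<bar>f x - s x\<bar> \<partial>\<rho>)" by (rule integral_abs_bound)
    also have "\<dots> \<le> (\<integral>x. e + (1 - indicator (B K) x) \<partial>\<rho>)"
      using approx int_f int_s ind ci by (intro integral_mono) auto
    also have "\<dots> = e + (1 - measure \<rho> (B K))"
      using ind ci by (simp add: sp prob_space[unfolded sp])
    finally show "\<bar>integral\<^sup>L \<rho> f - integral\<^sup>L \<rho> s\<bar> \<le> e + (1 - measure \<rho> (B K))" .
  qed
  have "(\<lambda>n. integral\<^sup>L (\<mu> n) s) \<longlonglongrightarrow> integral\<^sup>L \<nu> s"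
    unfolding integral_s[OF prob(1) sets(1)] integral_s[OF prob(2) sets(2)] cell_eq
    by (intro tendsto_intros box_conv)
  from tendstoD[OF this e(1)]
  have 1: "\<forall>\<^sub>F n in sequentially. \<bar>integral\<^sup>L (\<mu> n) s - integral\<^sup>L \<nu> s\<bar> < e"
    by (simp add: dist_real_def)
  have "(\<lambda>n. measure (\<mu> n) (B K)) \<longlonglongrightarrow> measure \<nu> (B K)"
    unfolding B_def by (rule box_conv)
  from order_tendstoD(1)[OF this K]
  have 2: "\<forall>\<^sub>F n in sequentially. 1 - e < measure (\<mu> n) (B K)" .
  show "\<forall>\<^sub>F n in sequentially. dist (integral\<^sup>L (\<mu> n) f) (integral\<^sup>L \<nu> f) < e0"
    using 1 2
  proof eventually_elim
    case (elim n)
    then show ?case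
      using error[OF prob(1) sets(1), of n] error[OF prob(2) sets(2)] K e(2)
      unfolding dist_real_def by linarith
  qed
qed

text \<open>
  A continuous mapping theorem for random vectors. On the line, weak convergence can be tested on
  the ramp functions \<open>cts_step a b\<close>, and composing a ramp with \<open>h\<close> gives a bounded continuous
  function on the vector space.
\<close>

lemma joint_cdf_tendsto_imp_weak_conv_continuous_image:
  fixes \<mu> :: "nat \<Rightarrow> (real ^ 'i) measure" and h :: "real ^ 'i \<Rightarrow> real"
  assumes prob: "\<And>n. prob_space (\<mu> n)" "prob_space \<nu>"
    and sets: "\<And>n. sets (\<mu> n) = sets borel" "sets \<nu> = sets borel"
    and conv: "\<And>t. (\<lambda>n. measure (\<mu> n) {x. \<forall>i. x $ i \<le> t i}) \<longlonglongrightarrow> measure \<nu> {x. \<forall>i. x $ i \<le> t i}"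
    and cont: "continuous_on UNIV h"
  shows "weak_conv_m (\<lambda>n. distr (\<mu> n) borel h) (distr \<nu> borel h)"
proof (rule integral_cts_step_conv_imp_weak_conv)
  have h: "h \<in> borel_measurable borel" using cont by (rule borel_measurable_continuous_onI)
  have h': "h \<in> borel_measurable (\<mu> n)" "h \<in> borel_measurable \<nu>" for n
    using h by (simp_all add: measurable_cong_sets[OF sets(1) refl] measurable_cong_sets[OF sets(2) refl])
  show "real_distribution (distr (\<mu> n) borel h)" "real_distribution (distr \<nu> borel h)" for n
    using prob h' by (auto intro: prob_space.real_distribution_distr)
  fix a b :: real assume ab: "a < b"
  have step: "continuous_on UNIV (cts_step a b)"
    by (intro uniformly_continuous_imp_continuous cts_step_uniformly_continuous ab)
  have eq: "integral\<^sup>L (distr \<rho> borel h) (cts_step a b) = integral\<^sup>L \<rho> (\<lambda>x. cts_step a b (h x))"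
    if "h \<in> borel_measurable \<rho>" for \<rho>
    using that step by (intro integral_distr borel_measurable_continuous_onI)
  have "\<bar>cts_step a b r\<bar> \<le> 1" for r
    using ab by (auto simp: cts_step_def field_simps)
  then show "(\<lambda>n. integral\<^sup>L (distr (\<mu> n) borel h) (cts_step a b))
      \<longlonglongrightarrow> integral\<^sup>L (distr \<nu> borel h) (cts_step a b)"
    unfolding eq[OF h'(1)] eq[OF h'(2)]
    by (intro joint_cdf_tendsto_imp_integral_tendsto prob sets conv
        continuous_on_compose2[OF step cont]) auto
qed

section \<open>Continuity of the extreme value distributions\<close>

text \<open>
  The bound squeezes the Frechet distribution function to zero at the origin, the only point where
  its continuity is not visible from the formulas; it comes from \<open>exp (- y) \<le> 1 / y\<close>.
\<close>

lemma frechet_cdf_le_powr: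
  fixes x :: real
  assumes "\<alpha> > 0"
  shows "frechet_cdf \<alpha> x \<le> \<bar>x\<bar> powr \<alpha>"
proof (cases "x \<le> 0")
  case False
  then have "exp (- (x powr (- \<alpha>))) = inverse (exp (x powr (- \<alpha>)))" by (simp add: exp_minus)
  also have "\<dots> \<le> inverse (x powr (- \<alpha>))"
  proof (rule le_imp_inverse_le)
    show "x powr (- \<alpha>) \<le> exp (x powr (- \<alpha>))"
      using exp_ge_add_one_self[of "x powr (- \<alpha>)"] by linarith
  qed (use False in simp)
  also have "\<dots> = x powr \<alpha>" by (simp add: powr_minus)
  finally show ?thesis using False by (simp add: frechet_cdf_def)
qed (simp add: frechet_cdf_def)

lemma isCont_frechet_cdf:
  assumes "\<alpha> > 0"
  shows "isCont (frechet_cdf \<alpha>) x"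
proof -
  consider "x < 0" | "x = 0" | "0 < x" by linarith
  then show ?thesis
  proof cases
    case 1
    then have "\<forall>\<^sub>F y in nhds x. frechet_cdf \<alpha> y = 0"
      using eventually_nhds_in_open[of "{..<0}" x] by (auto elim!: eventually_mono simp: frechet_cdf_def)
    then show ?thesis by (subst isCont_cong) auto
  next
    case 2
    have "((\<lambda>y. \<bar>y\<bar> powr \<alpha>) \<longlongrightarrow> \<bar>0\<bar> powr \<alpha>) (at (0::real))"
      by (rule tendsto_powr') (use assms in \<open>auto intro!: tendsto_rabs_zero tendsto_ident_at\<close>)
    then have upper: "((\<lambda>y. \<bar>y\<bar> powr \<alpha>) \<longlongrightarrow> 0) (at (0::real))" by simp
    have lower: "0 \<le> frechet_cdf \<alpha> y" for y by (simp add: frechet_cdf_def)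
    have "(frechet_cdf \<alpha> \<longlongrightarrow> 0) (at 0)"
      by (rule tendsto_sandwich[OF _ _ tendsto_const upper])
        (simp_all only: lower frechet_cdf_le_powr[OF assms] eventually_True)
    then show ?thesis using 2 by (simp add: isCont_def frechet_cdf_def)
  next
    case 3
    then have "\<forall>\<^sub>F y in nhds x. frechet_cdf \<alpha> y = exp (- (y powr (- \<alpha>)))"
      using eventually_nhds_in_open[of "{0<..}" x] by (auto elim!: eventually_mono simp: frechet_cdf_def)
    then show ?thesis using 3 by (subst isCont_cong) (auto intro!: continuous_intros)
  qed
qed

lemma isCont_extreme_value_cdf:
  assumes "extreme_value_cdf G"
  shows "isCont G x"
proof -
  have weibull: "isCont (weibull_cdf \<alpha>) x" if "\<alpha> > 0" for \<alpha>
  proof -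
    have "weibull_cdf \<alpha> = (\<lambda>x. exp (- (max 0 (- x) powr \<alpha>)))"
      using that by (auto simp: weibull_cdf_def fun_eq_iff max_def)
    moreover have "continuous_on UNIV (\<lambda>x. exp (- (max 0 (- x) powr \<alpha>)))"
      using that by (intro continuous_intros continuous_on_powr') auto
    ultimately show ?thesis by (simp add: continuous_on_eq_continuous_at)
  qed
  have "isCont gumbel_cdf x"
    unfolding gumbel_cdf_def[abs_def] by (intro continuous_intros)
  with weibull assms isCont_frechet_cdf show ?thesis
    unfolding extreme_value_cdf_def by blast
qed

section \<open>Joint distribution of the group extremes\<close>

text \<open>
  From \<open>p n ^ n \<le> exp (- n (1 - p n))\<close>: if the left-hand side does not vanish in the limit, the
  expected number \<open>n (1 - p n)\<close> of exceedances stays bounded.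
\<close>

lemma bounded_exceedance_rate:
  fixes p :: "nat \<Rightarrow> real"
  assumes p: "\<And>n. 0 \<le> p n" "\<And>n. p n \<le> 1"
    and lim: "(\<lambda>n. p n ^ n) \<longlonglongrightarrow> g" and g: "0 < g"
  obtains C where "\<forall>\<^sub>F n in sequentially. real n * (1 - p n) \<le> C"
proof -
  have "\<forall>\<^sub>F n in sequentially. g / 2 < p n ^ n"
    using order_tendstoD(1)[OF lim, of "g / 2"] g by simp
  then have "\<forall>\<^sub>F n in sequentially. real n * (1 - p n) \<le> - ln (g / 2)"
  proof eventually_elim
    case (elim n)
    have "p n \<le> exp (- (1 - p n))" using exp_ge_add_one_self[of "- (1 - p n)"] by simp
    then have "p n ^ n \<le> exp (- (1 - p n)) ^ n" using p by (intro power_mono)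
    also have "\<dots> = exp (- (real n * (1 - p n)))" 
      unfolding exp_of_nat_mult[symmetric] by (simp add: algebra_simps)
    finally have "ln (g / 2) \<le> ln (exp (- (real n * (1 - p n))))"
      using elim g by (subst ln_le_cancel_iff) auto
    then show ?case by simp
  qed
  then show thesis by (rule that)
qed

text \<open>
  Maximum and minimum of a sample are asymptotically independent. With \<open>p n = P(\<epsilon> \<le> s)\<close> and
  \<open>q n = P(- \<epsilon> \<le> t)\<close> the probability that one error lies in \<open>[- t, s]\<close> is
  \<open>max 0 (p n + q n - 1)\<close>. It differs from the product \<open>p n * q n\<close>, which independence would give,
  by at most \<open>(1 - p n) * (1 - q n)\<close>; this is of order \<open>1 / n\<^sup>2\<close> when both limits are positive, so
  that the \<open>n\<close>-th powers differ by order \<open>1 / n\<close>. When one limit vanishes, both sides do.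
\<close>

lemma asymptotic_independence_of_extremes:
  fixes p q :: "nat \<Rightarrow> real"
  assumes p: "\<And>n. 0 \<le> p n" "\<And>n. p n \<le> 1" and q: "\<And>n. 0 \<le> q n" "\<And>n. q n \<le> 1"
    and limp: "(\<lambda>n. p n ^ n) \<longlonglongrightarrow> g" and limq: "(\<lambda>n. q n ^ n) \<longlonglongrightarrow> g'"
  shows "(\<lambda>n. max 0 (p n + q n - 1) ^ n) \<longlonglongrightarrow> g * g'"
proof -
  define r where "r n = max 0 (p n + q n - 1)" for n
  have r: "0 \<le> r n" "r n \<le> p n" "r n \<le> q n" "r n \<le> 1" for n
    using p[of n] q[of n] by (auto simp: r_def)
  have zero: "(\<lambda>n. r n ^ n) \<longlonglongrightarrow> 0"
    if "(\<lambda>n. s n ^ n) \<longlonglongrightarrow> 0" "\<And>n. r n \<le> s n" for s :: "nat \<Rightarrow> real"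
    by (rule tendsto_sandwich[OF _ _ tendsto_const that(1)])
      (auto intro!: always_eventually power_mono r(1) that(2) zero_le_power)
  have "0 \<le> g" "0 \<le> g'"
    using limp limq p q by (auto intro!: LIMSEQ_le_const)
  then consider "g = 0" | "g' = 0" | "0 < g" "0 < g'" by linarith
  then have "(\<lambda>n. r n ^ n) \<longlonglongrightarrow> g * g'"
  proof cases
    case 1
    then show ?thesis using zero[of p] limp r by simp
  next
    case 2
    then show ?thesis using zero[of q] limq r by simp
  next
    case 3
    obtain C where C: "\<forall>\<^sub>F n in sequentially. real n * (1 - p n) \<le> C"
      using bounded_exceedance_rate[OF p limp 3(1)] .
    obtain C' where C': "\<forall>\<^sub>F n in sequentially. real n * (1 - q n) \<le> C'"
      using bounded_exceedance_rate[OF q limq 3(2)] .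
    have "\<forall>\<^sub>F n in sequentially. norm (r n ^ n - (p n * q n) ^ n) \<le> C * C' / real n"
      using C C' eventually_gt_at_top[of 0]
    proof eventually_elim
      case (elim n)
      have pq: "0 \<le> p n * q n" "p n * q n \<le> 1"
        using p[of n] q[of n] by (auto intro: mult_le_one)
      have "p n + q n - 1 \<le> p n * q n" "p n * q n - (p n + q n - 1) = (1 - p n) * (1 - q n)"
        using mult_nonneg_nonneg[of "1 - p n" "1 - q n"] p(2)[of n] q(2)[of n]
        by (auto simp: algebra_simps)
      then have "\<bar>r n - p n * q n\<bar> \<le> (1 - p n) * (1 - q n)"
        using pq by (auto simp: r_def max_def)
      moreover have "norm (r n ^ n - (p n * q n) ^ n) \<le> real n * norm (r n - p n * q n)"
        using r[of n] pq by (intro norm_power_diff) auto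
      ultimately have "norm (r n ^ n - (p n * q n) ^ n) \<le> real n * ((1 - p n) * (1 - q n))"
        by (smt (verit) mult_left_mono of_nat_0_le_iff real_norm_def)
      also have "\<dots> = (real n * (1 - p n)) * (real n * (1 - q n)) / real n"
        using elim by simp
      also have "\<dots> \<le> C * C' / real n"
        using elim p(2)[of n] q(2)[of n]
        by (intro divide_right_mono mult_mono) (auto intro: order_trans[rotated])
      finally show ?case .
    qed
    then have "(\<lambda>n. r n ^ n - (p n * q n) ^ n) \<longlonglongrightarrow> 0"
      by (rule Lim_null_comparison) (rule lim_const_over_n)
    moreover have "(\<lambda>n. (p n * q n) ^ n) \<longlonglongrightarrow> g * g'"
      unfolding power_mult_distrib by (intro tendsto_mult limp limq)
    ultimately show ?thesis using tendsto_add by fastforce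
  qed
  then show ?thesis by (simp add: r_def)
qed

text \<open>
  By symmetry \<open>{- t..}\<close> has the mass of \<open>{..t}\<close>. Either the two half-lines \<open>{- t..}\<close> and \<open>{..s}\<close>
  cover the line, and inclusion and exclusion gives the mass of their intersection, or they are
  disjoint, and their masses add up to at most one.
\<close>

lemma (in real_distribution) symmetric_interval_measure:
  assumes sym: "distr M borel uminus = M"
  shows "measure M {- t..s} = max 0 (cdf M s + cdf M t - 1)"
proof -
  have "measure M {- t..} = measure (distr M borel uminus) {..t}"
    by (subst measure_distr) (auto intro!: arg_cong[where f = "measure M"])
  then have t: "measure M {- t..} = cdf M t" by (simp add: sym cdf_def)
  have Un: "measure M ({- t..} \<union> {..s}) = cdf M t + cdf M s - measure M ({- t..} \<inter> {..s})"
    using measure_Un3[of "{- t..}" M "{..s}"] by (simp add: t cdf_def fmeasurable_eq_sets)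
  show ?thesis
  proof (cases "- t \<le> s")
    case True
    then have "{- t..} \<union> {..s} = UNIV" by auto
    then have "measure M {- t..s} = cdf M s + cdf M t - 1"
      using Un prob_space by (simp add: atLeastAtMost_def)
    then show ?thesis by (metis max_absorb2 measure_nonneg)
  next
    case False
    then have "{- t..} \<inter> {..s} = {}" "{- t..s} = {}" by auto
    then show ?thesis using Un prob_le_1[of "{- t..} \<union> {..s}"] by simp
  qed
qed

text \<open>
  The event says that every error of group \<open>l\<close> lies in \<open>[- t l, s l]\<close>. Independence turns its
  probability into a product over all errors, and disjointness of the groups lets each error have
  the interval of its own group.
\<close>

lemma (in prob_space) prob_group_extremes_le:
  fixes e :: "nat \<Rightarrow> 'a \<Rightarrow> real" and J :: "'k::finite \<Rightarrow> nat set"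
  assumes indep: "indep_vars (\<lambda>_. borel) e T"
    and distr: "\<And>j. j \<in> T \<Longrightarrow> distr M borel (e j) = \<mu>"
    and sym: "distr \<mu> borel uminus = \<mu>"
    and J: "\<And>l. J l \<subseteq> T" "disjoint_family J" "\<And>l. finite (J l)" "\<And>l. J l \<noteq> {}"
  shows "prob {\<omega> \<in> space M. \<forall>l. Max ((\<lambda>j. e j \<omega>) ` J l) \<le> s l \<and> Max ((\<lambda>j. - e j \<omega>) ` J l) \<le> t l}
    = (\<Prod>l\<in>UNIV. max 0 (cdf \<mu> (s l) + cdf \<mu> (t l) - 1) ^ card (J l))"
proof -
  have rv: "random_variable borel (e j)" if "j \<in> T" for j
    using indep that by (auto simp: indep_vars_def)
  have "(\<Union>l. J l) \<noteq> {}" using J(4) by blast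
  then obtain j0 where "j0 \<in> T" using J(1) by blast
  then have "real_distribution \<mu>" using distr rv real_distribution_distr by metis
  then interpret \<mu>: real_distribution \<mu> .
  define L where "L j = (THE l. j \<in> J l)" for j
  have L: "L j = l" if "j \<in> J l" for j l
    unfolding L_def using that J(2) by (auto simp: disjoint_family_on_def intro!: the_equality)
  define A where "A j = {- t (L j)..s (L j)}" for j
  have "{\<omega> \<in> space M. \<forall>l. Max ((\<lambda>j. e j \<omega>) ` J l) \<le> s l \<and> Max ((\<lambda>j. - e j \<omega>) ` J l) \<le> t l}
      = {\<omega> \<in> space M. \<forall>l. \<forall>j\<in>J l. e j \<omega> \<le> s l \<and> - e j \<omega> \<le> t l}"
    using J(3,4) by auto
  also have "\<dots> = (\<Inter>j\<in>(\<Union>l. J l). e j -` A j \<inter> space M)"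
    using J(4) by (auto simp: A_def L minus_le_iff)
  also have "prob \<dots> = (\<Prod>j\<in>(\<Union>l. J l). prob (e j -` A j \<inter> space M))"
  proof (rule indep_varsD[OF indep])
    show "finite (\<Union>l. J l)" using J(3) by simp
    show "(\<Union>l. J l) \<subseteq> T" using J(1) by blast
  qed (use \<open>(\<Union>l. J l) \<noteq> {}\<close> in \<open>simp_all add: A_def\<close>)
  also have "\<dots> = (\<Prod>l\<in>UNIV. \<Prod>j\<in>J l. prob (e j -` A j \<inter> space M))"
    using J(2,3) by (intro prod.UNION_disjoint) (auto simp: disjoint_family_on_def)
  also have "\<dots> = (\<Prod>l\<in>UNIV. \<Prod>j\<in>J l. max 0 (cdf \<mu> (s l) + cdf \<mu> (t l) - 1))"
  proof (intro prod.cong refl)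
    fix l j assume j: "j \<in> J l"
    then have "j \<in> T" using J(1) by blast
    then have "prob (e j -` A j \<inter> space M) = measure \<mu> (A j)"
      using distr rv by (metis A_def atLeastAtMost_borel measure_distr)
    then show "prob (e j -` A j \<inter> space M) = max 0 (cdf \<mu> (s l) + cdf \<mu> (t l) - 1)"
      by (simp add: A_def L[OF j] \<mu>.symmetric_interval_measure[OF sym])
  qed
  finally show ?thesis by simp
qed

lemma (in prob_space) prob_all_le:
  fixes e :: "'i \<Rightarrow> 'a \<Rightarrow> real"
  assumes indep: "indep_vars (\<lambda>_. borel) e T"
    and distr: "\<And>j. j \<in> J \<Longrightarrow> cdf (distr M borel (e j)) = F"
    and J: "J \<subseteq> T" "finite J" "J \<noteq> {}"
  shows "prob {\<omega> \<in> space M. \<forall>j\<in>J. e j \<omega> \<le> t j} = (\<Prod>j\<in>J. F (t j))"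
proof -
  have "{\<omega> \<in> space M. \<forall>j\<in>J. e j \<omega> \<le> t j} = (\<Inter>j\<in>J. e j -` {..t j} \<inter> space M)"
    using J(3) by auto
  also have "prob \<dots> = (\<Prod>j\<in>J. prob (e j -` {..t j} \<inter> space M))"
    using J by (intro indep_varsD[OF indep]) auto
  also have "\<dots> = (\<Prod>j\<in>J. F (t j))"
  proof (rule prod.cong)
    fix j assume j: "j \<in> J"
    then have "random_variable borel (e j)" using indep J(1) by (auto simp: indep_vars_def)
    then show "prob (e j -` {..t j} \<inter> space M) = F (t j)"
      using distr[OF j, symmetric] by (simp add: cdf_def measure_distr)
  qed simp
  finally show ?thesis .
qed

lemma borel_measurable_vec_lambda:
  assumes "\<And>i. (\<lambda>\<omega>. f i \<omega>) \<in> borel_measurable M"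
  shows "(\<lambda>\<omega>. (\<chi> i. f i \<omega>) :: real ^ 'i) \<in> borel_measurable M"
  by (subst borel_measurable_euclidean_space) (auto simp: Basis_vec_def inner_axis assms)

section \<open>The limit distribution of the minimax residual\<close>

theorem theorem1:
  fixes M :: "'a measure" and P :: "'b measure"
    and v :: "'k::finite \<Rightarrow> real ^ 'q"
    and \<theta> :: "real ^ 'q"
    and I :: "nat \<Rightarrow> 'k \<Rightarrow> nat set"
    and x :: "nat \<Rightarrow> nat \<Rightarrow> real ^ 'q"
    and \<epsilon> :: "nat \<Rightarrow> 'a \<Rightarrow> real"
    and y :: "nat \<Rightarrow> nat \<Rightarrow> 'a \<Rightarrow> real"
    and F G :: "real \<Rightarrow> real"
    and a b :: "nat \<Rightarrow> real"
    and \<zeta> \<zeta>' :: "'k \<Rightarrow> 'b \<Rightarrow> real"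
  assumes "prob_space M"
    and distinct: "inj v"
    and design_union: "\<And>n. n \<ge> 1 \<Longrightarrow> (\<Union>l. I n l) = {1..CARD('k) * n}"
    and design_disjoint: "\<And>n. n \<ge> 1 \<Longrightarrow> disjoint_family (I n)"
    and design_card: "\<And>n l. n \<ge> 1 \<Longrightarrow> card (I n l) = n"
    and design_points: "\<And>n l j. n \<ge> 1 \<Longrightarrow> j \<in> I n l \<Longrightarrow> x n j = v l"
    and model: "\<And>n j \<omega>. n \<ge> 1 \<Longrightarrow> j \<in> {1..CARD('k) * n} \<Longrightarrow> \<omega> \<in> space M \<Longrightarrow>
      y n j \<omega> = (\<Sum>i\<in>UNIV. \<theta> $ i * x n j $ i) + \<epsilon> j \<omega>"
    and errors_indep: "prob_space.indep_vars M (\<lambda>_. borel) \<epsilon> {1..}"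
    and errors_distr: "\<And>j. j \<ge> 1 \<Longrightarrow> cdf (distr M borel (\<epsilon> j)) = F"
    and A1: "\<And>j. j \<ge> 1 \<Longrightarrow> distr M borel (\<lambda>\<omega>. - \<epsilon> j \<omega>) = distr M borel (\<epsilon> j)"
    and A2_scale: "\<And>n. n \<ge> 1 \<Longrightarrow> b n > 0"
    and A2_evd: "extreme_value_cdf G"
    and A2_conv: "weak_conv
      (\<lambda>n. cdf (distr M borel (\<lambda>\<omega>. b n * (Max ((\<lambda>j. \<epsilon> j \<omega>) ` {1..n}) - a n)))) G"
    and "prob_space P"
    and zeta_indep: "prob_space.indep_vars P (\<lambda>_. borel) (case_sum \<zeta> \<zeta>') UNIV"
    and zeta_distr: "\<And>l. cdf (distr P borel (\<zeta> l)) = G" "\<And>l. cdf (distr P borel (\<zeta>' l)) = G"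
  shows "weak_conv_m
    (\<lambda>n. distr M borel
       (\<lambda>\<omega>. b n * (minimax_residual (CARD('k) * n) (x n) (\<lambda>j. y n j \<omega>) - a n)))
    (distr P borel (\<lambda>\<omega>. max_Lstar v (\<lambda>l. \<zeta> l \<omega>) (\<lambda>l. \<zeta>' l \<omega>)))"
proof -
  interpret M: prob_space M by fact
  interpret P: prob_space P by fact
  have rv: "\<epsilon> j \<in> borel_measurable M" if "j \<ge> 1" for j
    using errors_indep that by (auto simp: M.indep_vars_def)
  have rv_zeta: "case_sum \<zeta> \<zeta>' i \<in> borel_measurable P" for i
    using zeta_indep by (auto simp: P.indep_vars_def)
  define \<mu> where "\<mu> = distr M borel (\<epsilon> 1)"
  interpret \<mu>: real_distribution \<mu>
    unfolding \<mu>_def by (intro M.real_distribution_distr rv) simp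
  have F: "F = cdf \<mu>" using errors_distr[of 1] by (simp add: \<mu>_def)
  have law: "distr M borel (\<epsilon> j) = \<mu>" if "j \<ge> 1" for j
    using errors_distr[OF that] F rv[OF that]
    by (intro cdf_unique M.real_distribution_distr \<mu>.real_distribution_axioms) simp_all
  have sym: "distr \<mu> borel uminus = \<mu>"
    using A1[of 1] rv[of 1] by (simp add: \<mu>_def distr_distr comp_def)

  (* The threshold for the raw maxima that corresponds to r on the normalised scale. *)
  define s where "s n r = a n + r / b n" for n and r :: real
  have scale: "b n * (z - a n) \<le> r \<longleftrightarrow> z \<le> s n r" if "n \<ge> 1" for n z r
    using A2_scale[OF that] by (simp add: s_def field_simps)
  have F_lim: "(\<lambda>n. F (s n r) ^ n) \<longlonglongrightarrow> G r" for r
  proof -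
    have eq: "cdf (distr M borel (\<lambda>\<omega>. b n * (Max ((\<lambda>j. \<epsilon> j \<omega>) ` {1..n}) - a n))) r = F (s n r) ^ n"
      if n: "n \<ge> 1" for n
    proof -
      have "(\<lambda>\<omega>. Max ((\<lambda>j. \<epsilon> j \<omega>) ` {1..n})) \<in> borel_measurable M"
        by (intro borel_measurable_Max rv) auto
      then have "cdf (distr M borel (\<lambda>\<omega>. b n * (Max ((\<lambda>j. \<epsilon> j \<omega>) ` {1..n}) - a n))) r
          = M.prob {\<omega> \<in> space M. b n * (Max ((\<lambda>j. \<epsilon> j \<omega>) ` {1..n}) - a n) \<le> r}"
        unfolding cdf_def by (subst measure_distr) (auto intro!: arg_cong[where f = M.prob])
      also have "\<dots> = M.prob {\<omega> \<in> space M. \<forall>j\<in>{1..n}. \<epsilon> j \<omega> \<le> s n r}"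
        using n by (simp add: scale)
      also have "\<dots> = F (s n r) ^ n"
        using n by (subst M.prob_all_le[OF errors_indep errors_distr]) auto
      finally show ?thesis .
    qed
    have "(\<lambda>n. cdf (distr M borel (\<lambda>\<omega>. b n * (Max ((\<lambda>j. \<epsilon> j \<omega>) ` {1..n}) - a n))) r)
        \<longlonglongrightarrow> G r"
      using A2_conv isCont_extreme_value_cdf[OF A2_evd] by (auto simp: weak_conv_def)
    then show ?thesis
      by (rule Lim_transform_eventually) (rule eventually_sequentiallyI[of 1], rule eq)
  qed

  (* Z collects the largest errors and the negated smallest errors of all groups; X is its
     normalisation and Y the limit vector, and h is the dual value as a function of such a vector. *)
  define Z where "Z n \<omega> = case_sum (\<lambda>l. Max ((\<lambda>j. \<epsilon> j \<omega>) ` I n l)) (\<lambda>l. Max ((\<lambda>j. - \<epsilon> j \<omega>) ` I n l))"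
    for n \<omega>
  define X :: "nat \<Rightarrow> 'a \<Rightarrow> real ^ ('k + 'k)" where "X n \<omega> = (\<chi> i. b n * (Z n \<omega> i - a n))" for n \<omega>
  define Y :: "'b \<Rightarrow> real ^ ('k + 'k)" where "Y \<omega> = (\<chi> i. case_sum \<zeta> \<zeta>' i \<omega>)" for \<omega>
  define h :: "real ^ ('k + 'k) \<Rightarrow> real" where "h x = max_Lstar v (\<lambda>l. x $ Inl l) (\<lambda>l. x $ Inr l)" for x
  have h_cont: "continuous_on UNIV h"
    unfolding h_def[abs_def] by (rule continuous_on_max_Lstar)
  then have h_meas: "h \<in> borel_measurable borel" by (rule borel_measurable_continuous_onI)
  have group: "I n l \<subseteq> {1..}" "finite (I n l)" "I n l \<noteq> {}" if "n \<ge> 1" for n l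
    using design_union[OF that] design_card[OF that, of l] that
    by (auto intro: card_ge_0_finite)
  have X_meas: "X n \<in> borel_measurable M" if n: "n \<ge> 1" for n
  proof -
    have "\<epsilon> j \<in> borel_measurable M" if "j \<in> I n l" for j l
      using group(1)[OF n, of l] that rv by blast
    then have "(\<lambda>\<omega>. Z n \<omega> i) \<in> borel_measurable M" for i
      by (cases i) (auto simp: Z_def group[OF n] intro!: borel_measurable_Max borel_measurable_uminus)
    then show ?thesis
      unfolding X_def[abs_def] by (intro borel_measurable_vec_lambda borel_measurable_times
          borel_measurable_diff borel_measurable_const)
  qed
  have Y_meas: "Y \<in> borel_measurable P"
    unfolding Y_def[abs_def] by (intro borel_measurable_vec_lambda rv_zeta)
  have orthant: "{x :: real ^ ('k + 'k). \<forall>i. x $ i \<le> t i} \<in> sets borel" for t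
    by measurable

  have X_cdf: "measure (distr M borel (X n)) {x. \<forall>i. x $ i \<le> t i}
      = (\<Prod>l\<in>UNIV. max 0 (F (s n (t (Inl l))) + F (s n (t (Inr l))) - 1) ^ n)"
    if n: "n \<ge> 1" for n t
  proof -
    have "measure (distr M borel (X n)) {x. \<forall>i. x $ i \<le> t i}
        = M.prob {\<omega> \<in> space M. \<forall>i. X n \<omega> $ i \<le> t i}"
      using X_meas[OF n] orthant by (subst measure_distr) (auto intro!: arg_cong[where f = M.prob])
    also have "\<dots> = M.prob {\<omega> \<in> space M. \<forall>l. Max ((\<lambda>j. \<epsilon> j \<omega>) ` I n l) \<le> s n (t (Inl l))
        \<and> Max ((\<lambda>j. - \<epsilon> j \<omega>) ` I n l) \<le> s n (t (Inr l))}"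
      by (simp add: X_def Z_def scale[OF n] split_sum_all all_conj_distrib)
    also have "\<dots> = (\<Prod>l\<in>UNIV. max 0 (F (s n (t (Inl l))) + F (s n (t (Inr l))) - 1) ^ n)"
      using n group(1)[OF n] by (subst M.prob_group_extremes_le[OF errors_indep law sym])
        (simp_all add: group design_disjoint design_card F)
    finally show ?thesis .
  qed
  have Y_cdf: "measure (distr P borel Y) {x. \<forall>i. x $ i \<le> t i}
      = (\<Prod>l\<in>UNIV. G (t (Inl l)) * G (t (Inr l)))" for t
  proof -
    have "measure (distr P borel Y) {x. \<forall>i. x $ i \<le> t i}
        = P.prob {\<omega> \<in> space P. \<forall>i\<in>UNIV. case_sum \<zeta> \<zeta>' i \<omega> \<le> t i}"
      using Y_meas orthant
      by (subst measure_distr) (auto simp: Y_def intro!: arg_cong[where f = P.prob])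
    also have "\<dots> = (\<Prod>i\<in>UNIV. G (t i))"
    proof (rule P.prob_all_le[OF zeta_indep])
      show "cdf (distr P borel (case_sum \<zeta> \<zeta>' i)) = G" for i
        using zeta_distr by (cases i) auto
    qed auto
    also have "\<dots> = (\<Prod>l\<in>UNIV. G (t (Inl l)) * G (t (Inr l)))"
      by (simp add: UNIV_Plus_UNIV[symmetric] prod.Plus prod.distrib del: UNIV_Plus_UNIV)
    finally show ?thesis .
  qed
  (* Index n = 0 is skipped: there the groups are unconstrained and X 0 need not be measurable. *)
  have joint: "(\<lambda>n. measure (distr M borel (X (Suc n))) {x. \<forall>i. x $ i \<le> t i})
      \<longlonglongrightarrow> measure (distr P borel Y) {x. \<forall>i. x $ i \<le> t i}" for t
  proof -
    have "(\<lambda>n. \<Prod>l\<in>UNIV. max 0 (F (s n (t (Inl l))) + F (s n (t (Inr l))) - 1) ^ n)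
        \<longlonglongrightarrow> (\<Prod>l\<in>UNIV. G (t (Inl l)) * G (t (Inr l)))"
      by (intro tendsto_prod asymptotic_independence_of_extremes F_lim)
        (simp_all add: F \<mu>.cdf_nonneg \<mu>.cdf_bounded_prob)
    from LIMSEQ_Suc[OF this] show ?thesis by (simp add: X_cdf Y_cdf)
  qed

  have "weak_conv_m (\<lambda>n. distr (distr M borel (X (Suc n))) borel h) (distr (distr P borel Y) borel h)"
    by (rule joint_cdf_tendsto_imp_weak_conv_continuous_image[OF _ _ _ _ joint h_cont])
      (simp_all add: M.prob_space_distr P.prob_space_distr X_meas Y_meas)
  moreover have "distr (distr P borel Y) borel h
      = distr P borel (\<lambda>\<omega>. max_Lstar v (\<lambda>l. \<zeta> l \<omega>) (\<lambda>l. \<zeta>' l \<omega>))"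
    using Y_meas h_meas by (simp add: distr_distr comp_def h_def Y_def)
  moreover have "distr (distr M borel (X n)) borel h = distr M borel
      (\<lambda>\<omega>. b n * (minimax_residual (CARD('k) * n) (x n) (\<lambda>j. y n j \<omega>) - a n))" if n: "n \<ge> 1" for n
  proof -
    have "h (X n \<omega>) = b n * (minimax_residual (CARD('k) * n) (x n) (\<lambda>j. y n j \<omega>) - a n)"
      if \<omega>: "\<omega> \<in> space M" for \<omega>
    proof -
      have "minimax_residual (CARD('k) * n) (x n) (\<lambda>j. y n j \<omega>)
          = max_Lstar v (\<lambda>l. Max ((\<lambda>j. \<epsilon> j \<omega>) ` I n l)) (\<lambda>l. Max ((\<lambda>j. - \<epsilon> j \<omega>) ` I n l))"
        using n by (intro minimax_residual_eq_max_Lstar[where \<theta> = \<theta>])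
          (simp_all add: Suc_le_eq design_union group design_points model[OF n _ \<omega>] inner_vec_def)
      then show ?thesis
        using A2_scale[OF n] by (simp add: h_def X_def Z_def max_Lstar_affine)
    qed
    then show ?thesis
      using X_meas[OF n] h_meas by (simp add: distr_distr comp_def cong: distr_cong)
  qed
  ultimately have "weak_conv_m (\<lambda>n. distr M borel (\<lambda>\<omega>. b (Suc n) *
        (minimax_residual (CARD('k) * Suc n) (x (Suc n)) (\<lambda>j. y (Suc n) j \<omega>) - a (Suc n))))
      (distr P borel (\<lambda>\<omega>. max_Lstar v (\<lambda>l. \<zeta> l \<omega>) (\<lambda>l. \<zeta>' l \<omega>)))"
    by simp
  then show ?thesis
    unfolding weak_conv_m_def weak_conv_def by (blast intro: LIMSEQ_imp_Suc)
qed

end
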